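(* For every real $t$ with $0\le t\le 1$, all of the following hold: (1) $\displaystyle \chi_2(t)=\int_0^1\frac{\sin^{-1}(tu)}{\sqrt{1-u^2}}\,du$; (2) $\displaystyle \frac14\mathrm{Li}_2(t^2)=\frac1\pi\int_0^1\frac{(\sin^{-1}(tu))^2}{\sqrt{1-u^2}}\,du$; (3) $\displaystyle \mathrm{Li}_2(t)=\int_0^1\frac{\sin^{-1}(tu)+\frac1\pi(\sin^{-1}(tu))^2}{\sqrt{1-u^2}}\,du$; (4) $\displaystyle \mathrm{Ti}_2(t)=\int_0^1\frac{\sinh^{-1}(tu)}{\sqrt{1-u^2}}\,du$; (5) $\displaystyle \frac{\pi}{2}\left(\frac14\mathrm{Li}_2(t^2)-\frac18\mathrm{Li}_2(t^4)\right)=\int_0^1\frac{\frac12(\sinh^{-1}(tu))^2}{\sqrt{1-u^2}}\,du$.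
   Context: For $0\le t\le 1$: $\mathrm{Li}_2(t)=\sum_{n=1}^\infty \frac{t^n}{n^2}$ (dilogarithm), $\chi_2(t)=\sum_{n=1}^\infty\frac{t^{2n-1}}{(2n-1)^2}$ (Legendre $\chi$ function of order 2), and $\mathrm{Ti}_2(t)=\sum_{n=1}^\infty\frac{(-1)^{n-1}}{(2n-1)^2}t^{2n-1}$ (inverse tangent integral of order 2). Here $\sin^{-1}$ is the real inverse sine with values in $[-\pi/2,\pi/2]$, and $\sinh^{-1}x=\log(x+\sqrt{x^2+1})$ is the inverse hyperbolic sine. *)

theory Defs
  imports "HOL-Analysis.Analysis"
begin

text \<open>
  The three series converge for \<open>0 \<le> t \<le> 1\<close>, the only range in which they are used.
  Summation indices are shifted to start at 0.
\<close>

definition Li2 :: "real \<Rightarrow> real" where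
  "Li2 t = (\<Sum>n. t ^ (n + 1) / (real (n + 1))\<^sup>2)"

definition chi2 :: "real \<Rightarrow> real" where
  "chi2 t = (\<Sum>n. t ^ (2 * n + 1) / (real (2 * n + 1))\<^sup>2)"

definition Ti2 :: "real \<Rightarrow> real" where
  "Ti2 t = (\<Sum>n. (-1) ^ n / (real (2 * n + 1))\<^sup>2 * t ^ (2 * n + 1))"

end

theory Submission
  imports Defs
begin

text \<open>
  All five identities are instances of one formula. Let \<open>|s| \<le> 1\<close> and let \<open>F\<close> be the
  primitive of \<open>1 / sqrt (1 - s x\<^sup>2)\<close> with \<open>F 0 = 0\<close>, so that \<open>F\<close> is \<open>arcsin\<close> for \<open>s = 1\<close> and
  \<open>arsinh\<close> for \<open>s = -1\<close>. Every combination \<open>f = p F + (q/2) F\<^sup>2\<close> solves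

    \<open>(1 - s x\<^sup>2) f'' - s x f' = q\<close>, \<open>f 0 = 0\<close>, \<open>f' 0 = p\<close>,

  so its Taylor coefficients \<open>a\<^sub>n\<close> satisfy \<open>(n+1)(n+2) a\<^sub>n\<^sub>+\<^sub>2 = s n\<^sup>2 a\<^sub>n\<close> for \<open>n > 0\<close>. On the other
  side, the integrals \<open>W\<^sub>n\<close> of \<open>u^n / sqrt (1 - u\<^sup>2)\<close> over the unit interval satisfy Wallis'
  recurrence \<open>(n+2) W\<^sub>n\<^sub>+\<^sub>2 = (n+1) W\<^sub>n\<close>. The factors \<open>n+1\<close> cancel in the product:

    \<open>(n+2)\<^sup>2 a\<^sub>n\<^sub>+\<^sub>2 W\<^sub>n\<^sub>+\<^sub>2 = s n\<^sup>2 a\<^sub>n W\<^sub>n\<close>,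

  which makes \<open>a\<^sub>n W\<^sub>n\<close> a constant times a power of \<open>s\<close> over \<open>n\<^sup>2\<close>, with one constant for odd
  and one for even \<open>n\<close> (\<open>wallis_ode_coeff_odd\<close>, \<open>wallis_ode_coeff_even\<close>). Integrating the
  power series of \<open>f (t u)\<close> term by term against \<open>1 / sqrt (1 - u\<^sup>2)\<close> therefore yields \<open>p\<close> times
  a series over odd squares (\<open>\<chi>\<^sub>2\<close> or \<open>Ti\<^sub>2\<close>) plus \<open>q \<pi> / 8\<close> times a dilogarithm series in \<open>t\<^sup>2\<close>,
  alternating if \<open>s = -1\<close> (\<open>has_integral_arc_over_sqrt\<close>). Sorting the terms of the
  dilogarithm by parity rewrites these series in the required form.
\<close>

section \<open>Wallis integrals\<close>

fun wallis :: "nat \<Rightarrow> real" where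
  "wallis 0 = pi / 2"
| "wallis (Suc 0) = 1"
| "wallis (Suc (Suc n)) = real (n + 1) / real (n + 2) * wallis n"

lemma wallis_nonneg: "0 \<le> wallis n"
  by (induction n rule: wallis.induct) auto

text \<open>
  The recurrence comes from integrating the derivative of \<open>u ^ (n + 1) * sqrt (1 - u\<^sup>2)\<close>, a
  function that vanishes at both endpoints. The integrands are singular at \<open>1\<close>, but all the
  primitives are continuous on the closed interval, so the fundamental theorem with
  differentiability in the interior applies.
\<close>
lemma has_integral_wallis:
  "((\<lambda>u. u ^ n / sqrt (1 - u\<^sup>2)) has_integral wallis n) {0..1}"
proof (induction n rule: wallis.induct)
  case 1
  have "((\<lambda>u. inverse (sqrt (1 - u\<^sup>2))) has_integral (arcsin 1 - arcsin 0)) {0..1}"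
  proof (rule fundamental_theorem_of_calculus_interior)
    show "continuous_on {0..1} arcsin"
      by (rule continuous_on_subset[OF continuous_on_arcsin']) auto
    show "(arcsin has_vector_derivative inverse (sqrt (1 - u\<^sup>2))) (at u)" if "u \<in> {0<..<1}" for u
      using that DERIV_arcsin[of u] by (simp add: has_real_derivative_iff_has_vector_derivative)
  qed auto
  then show ?case
    by (simp add: inverse_eq_divide)
next
  case 2
  have "((\<lambda>u. u / sqrt (1 - u\<^sup>2)) has_integral (- sqrt (1 - 1\<^sup>2) - - sqrt (1 - 0\<^sup>2))) {0..1}"
  proof (rule fundamental_theorem_of_calculus_interior)
    show "continuous_on {0..1} (\<lambda>u::real. - sqrt (1 - u\<^sup>2))"
      by (intro continuous_intros)
    show "((\<lambda>u. - sqrt (1 - u\<^sup>2)) has_vector_derivative u / sqrt (1 - u\<^sup>2)) (at u)"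
      if "u \<in> {0<..<1}" for u :: real
    proof -
      have "0 < 1 - u\<^sup>2"
        using that by (simp add: power_less_one_iff)
      then have "((\<lambda>u. - sqrt (1 - u\<^sup>2)) has_real_derivative u / sqrt (1 - u\<^sup>2)) (at u)"
        by (auto intro!: derivative_eq_intros simp: field_simps)
      then show ?thesis
        by (simp add: has_real_derivative_iff_has_vector_derivative)
    qed
  qed auto
  then show ?case
    by simp
next
  case (3 n)
  let ?w = "\<lambda>n u::real. u ^ n / sqrt (1 - u\<^sup>2)"
  have "((\<lambda>u. real (n + 1) * ?w n u - real (n + 2) * ?w (n + 2) u) has_integral
      (1 ^ (n + 1) * sqrt (1 - 1\<^sup>2) - 0 ^ (n + 1) * sqrt (1 - 0\<^sup>2))) {0..1}"
  proof (rule fundamental_theorem_of_calculus_interior)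
    show "continuous_on {0..1} (\<lambda>u::real. u ^ (n + 1) * sqrt (1 - u\<^sup>2))"
      by (intro continuous_intros)
    show "((\<lambda>u. u ^ (n + 1) * sqrt (1 - u\<^sup>2)) has_vector_derivative
        real (n + 1) * ?w n u - real (n + 2) * ?w (n + 2) u) (at u)"
      if "u \<in> {0<..<1}" for u :: real
    proof -
      define r where "r = sqrt (1 - u\<^sup>2)"
      have pos: "0 < 1 - u\<^sup>2"
        using that by (simp add: power_less_one_iff)
      then have r: "0 < r" "r * r = 1 - u\<^sup>2"
        by (auto simp: r_def)
      have "((\<lambda>u. sqrt (1 - u\<^sup>2)) has_real_derivative - u / r) (at u)"
        unfolding r_def using pos by (auto intro!: derivative_eq_intros simp: field_simps)
      from DERIV_mult[OF DERIV_pow[of "n + 1" u] this]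
      have "((\<lambda>u. u ^ (n + 1) * sqrt (1 - u\<^sup>2)) has_real_derivative
          real (n + 1) * u ^ n * r - u ^ (n + 2) / r) (at u)"
        by (simp add: r_def mult_ac)
      also have "real (n + 1) * u ^ n * r - u ^ (n + 2) / r
          = (real (n + 1) * u ^ n * (r * r) - u ^ (n + 2)) / r"
        using r(1) by (simp add: field_simps)
      also have "\<dots> = real (n + 1) * (u ^ n / r) - real (n + 2) * (u ^ (n + 2) / r)"
        unfolding r(2) using r(1) by (simp add: field_simps power2_eq_square)
      finally show ?thesis
        by (simp add: has_real_derivative_iff_has_vector_derivative r_def)
    qed
  qed auto
  then have "((\<lambda>u. real (n + 1) * ?w n u - real (n + 2) * ?w (n + 2) u) has_integral 0) {0..1}"
    by simp
  from has_integral_diff[OF has_integral_mult_right[OF 3, of "real (n + 1)"] this]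
  have "((\<lambda>u. real (n + 2) * ?w (n + 2) u) has_integral real (n + 1) * wallis n) {0..1}"
    by simp
  from has_integral_mult_right[OF this, of "1 / real (n + 2)"]
  show ?case
    by (simp add: divide_simps)
qed

section \<open>Termwise integration\<close>

text \<open>
  At \<open>t = 1\<close> the argument \<open>t * u\<close> reaches the boundary of the disc of convergence only at the
  single point \<open>u = 1\<close>. What controls the interchange of sum and integral there is the
  summability of the integrals \<open>\<bar>a n\<bar> * wallis n\<close>, where the decay of the Wallis integrals
  helps.
\<close>
lemma has_integral_powser_over_sqrt:
  fixes a :: "nat \<Rightarrow> real" and f :: "real \<Rightarrow> real"
  assumes f: "\<And>x. \<lbrakk>0 \<le> x; x < 1\<rbrakk> \<Longrightarrow> (\<lambda>n. a n * x ^ n) sums f x"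
    and absf: "\<And>x. \<lbrakk>0 \<le> x; x < 1\<rbrakk> \<Longrightarrow> summable (\<lambda>n. \<bar>a n * x ^ n\<bar>)"
    and S: "(\<lambda>n. a n * wallis n * t ^ n) sums S"
    and absS: "summable (\<lambda>n. \<bar>a n * wallis n\<bar>)"
    and t: "0 \<le> t" "t \<le> 1"
  shows "((\<lambda>u. f (t * u) / sqrt (1 - u\<^sup>2)) has_integral S) {0..1}"
proof -
  let ?w = "\<lambda>n u::real. u ^ n / sqrt (1 - u\<^sup>2)"
  let ?I = "{0..1::real}"
  let ?g = "\<lambda>n u. a n * t ^ n * ?w n u"
  have w_nonneg: "0 \<le> ?w n u" if "u \<in> ?I" for n u
    using that by (simp add: power_le_one)
  have int_w: "integrable (lebesgue_on ?I) (?w n)" for n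
  proof -
    have "(\<lambda>u. ?w n u) absolutely_integrable_on ?I"
      using has_integral_wallis[of n] w_nonneg
      by (intro nonnegative_absolutely_integrable_1) auto
    then show ?thesis
      by (subst integrable_restrict_space) (auto simp: set_integrable_def)
  qed
  have eq_w: "integral\<^sup>L (lebesgue_on ?I) (?w n) = wallis n" for n
    using lebesgue_integral_eq_integral[OF int_w[of n]] has_integral_wallis[of n]
    by (simp add: integral_unique)
  have int_g: "integrable (lebesgue_on ?I) (?g n)" for n
    using int_w by (intro Bochner_Integration.integrable_mult_right)
  have pw: "(\<lambda>n. ?g n u) sums (f (t * u) / sqrt (1 - u\<^sup>2)) \<and> summable (\<lambda>n. norm (?g n u))"
    if "u \<in> ?I" for u
  \<comment> \<open>At \<open>u = 1\<close> everything vanishes, as division by \<open>sqrt 0\<close> gives \<open>0\<close>.\<close>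
  proof (cases "u = 1")
    case False
    then have "t * u \<le> u" "u < 1"
      using that t by (auto intro: mult_left_le_one_le)
    then have tu: "0 \<le> t * u" "t * u < 1"
      using that t by auto
    have eq: "?g n u = a n * (t * u) ^ n / sqrt (1 - u\<^sup>2)" for n
      by (simp add: power_mult_distrib)
    have "summable (\<lambda>n. \<bar>a n * (t * u) ^ n\<bar> / \<bar>sqrt (1 - u\<^sup>2)\<bar>)"
      by (intro summable_divide absf tu)
    then show ?thesis
      unfolding eq using sums_divide[OF f[OF tu]] by simp
  qed simp
  have norm_int: "(\<integral>u. norm (?g n u) \<partial>lebesgue_on ?I) = \<bar>a n * t ^ n\<bar> * wallis n" for n
  proof -
    have "(\<integral>u. norm (?g n u) \<partial>lebesgue_on ?I) = (\<integral>u. \<bar>a n * t ^ n\<bar> * ?w n u \<partial>lebesgue_on ?I)"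
    proof (rule Bochner_Integration.integral_cong)
      show "norm (?g n u) = \<bar>a n * t ^ n\<bar> * ?w n u" if "u \<in> space (lebesgue_on ?I)" for u
        using abs_of_nonneg[OF w_nonneg[of u n]] that
        by (simp only: real_norm_def abs_mult space_lebesgue_on)
    qed simp
    then show ?thesis
      by (simp only: integral_mult_right_zero eq_w)
  qed
  have sm: "summable (\<lambda>n. \<integral>u. norm (?g n u) \<partial>lebesgue_on ?I)"
    unfolding norm_int
  proof (rule summable_comparison_test'[OF absS])
    show "norm (\<bar>a n * t ^ n\<bar> * wallis n) \<le> \<bar>a n * wallis n\<bar>" for n
    proof -
      have "norm (\<bar>a n * t ^ n\<bar> * wallis n) = \<bar>a n * wallis n\<bar> * t ^ n"
        using t wallis_nonneg[of n] by (simp add: abs_mult)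
      also have "\<dots> \<le> \<bar>a n * wallis n\<bar> * 1"
        using t by (intro mult_left_mono power_le_one) auto
      finally show ?thesis
        by simp
    qed
  qed
  have AE: "AE u in lebesgue_on ?I. summable (\<lambda>n. norm (?g n u))"
    using pw by (intro AE_I2) auto
  note int_g AE sm
  note termwise = integrable_suminf[OF this] sums_integral[OF this]
  have "(\<lambda>n. integral\<^sup>L (lebesgue_on ?I) (?g n)) sums S"
    using S by (simp only: integral_mult_right_zero eq_w mult_ac)
  with termwise(2) have "integral\<^sup>L (lebesgue_on ?I) (\<lambda>u. \<Sum>n. ?g n u) = S"
    by (rule sums_unique2)
  with has_integral_integral_lebesgue_on[OF termwise(1)]
  have "((\<lambda>u. \<Sum>n. ?g n u) has_integral S) ?I"
    by simp
  then show ?thesis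
    by (rule has_integral_eq[rotated]) (use pw in \<open>auto simp: sums_iff\<close>)
qed

section \<open>Power series of arcsin, arsinh and their squares\<close>

text \<open>
  The Taylor coefficients at \<open>0\<close> of the solution of \<open>(1 - s x\<^sup>2) f'' - s x f' = q\<close> with
  \<open>f 0 = 0\<close> and \<open>f' 0 = p\<close>.
\<close>
fun ode_coeff :: "real \<Rightarrow> real \<Rightarrow> real \<Rightarrow> nat \<Rightarrow> real" where
  "ode_coeff s p q 0 = 0"
| "ode_coeff s p q (Suc 0) = p"
| "ode_coeff s p q (Suc (Suc n)) =
     (s * (real n)\<^sup>2 * ode_coeff s p q n + (if n = 0 then q else 0)) / (real (n + 1) * real (n + 2))"

text \<open>
  A crude bound, from \<open>n\<^sup>2 \<le> (n + 1) (n + 2)\<close>; it gives convergence of the series on the open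
  unit disc.
\<close>
lemma abs_ode_coeff_le:
  assumes s: "\<bar>s\<bar> \<le> 1"
  shows "\<bar>ode_coeff s p q n\<bar> \<le> \<bar>p\<bar> + \<bar>q\<bar>"
proof (induction n rule: induct_nat_012)
  case (ge2 n)
  show ?case
  proof (cases "n = 0")
    case False
    have "(real n)\<^sup>2 \<le> real (n + 1) * real (n + 2)"
      by (simp add: power2_eq_square algebra_simps)
    then have "\<bar>s\<bar> * (real n)\<^sup>2 \<le> real (n + 1) * real (n + 2)"
      using mult_left_le_one_le[of "(real n)\<^sup>2" "\<bar>s\<bar>"] s by (simp add: mult.commute)
    then have "\<bar>s\<bar> * (real n)\<^sup>2 * \<bar>ode_coeff s p q n\<bar> \<le> (real (n + 1) * real (n + 2)) * (\<bar>p\<bar> + \<bar>q\<bar>)"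
      by (rule mult_mono[OF _ ge2(1)]) auto
    then show ?thesis
      using False by (simp add: abs_mult pos_divide_le_eq mult.commute)
  qed auto
qed auto

lemma summable_abs_ode_series:
  assumes s: "\<bar>s\<bar> \<le> 1" and x: "\<bar>x\<bar> < 1"
  shows "summable (\<lambda>n. \<bar>ode_coeff s p q n * x ^ n\<bar>)"
proof (rule summable_comparison_test')
  show "summable (\<lambda>n. (\<bar>p\<bar> + \<bar>q\<bar>) * \<bar>x\<bar> ^ n)"
    using x by (intro summable_mult summable_geometric) auto
  show "norm \<bar>ode_coeff s p q n * x ^ n\<bar> \<le> (\<bar>p\<bar> + \<bar>q\<bar>) * \<bar>x\<bar> ^ n" for n
    using abs_ode_coeff_le[OF s] by (simp add: abs_mult power_abs mult_right_mono)
qed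

text \<open>
  Rather than differentiating \<open>p F + (q/2) F\<^sup>2\<close>, one integrates the differential equation twice.
  Divided by \<open>sqrt (1 - s x\<^sup>2)\<close>, it says that the sum \<open>g\<close> of the series satisfies
  \<open>(sqrt (1 - s x\<^sup>2) g')' = q F'\<close>, hence \<open>sqrt (1 - s x\<^sup>2) g' = p + q F\<close>, which is
  \<open>g' = p F' + q F F'\<close>.
\<close>
lemma ode_series_sums:
  fixes F :: "real \<Rightarrow> real"
  assumes s: "\<bar>s\<bar> \<le> 1" and F0: "F 0 = 0"
    and F': "\<And>x. \<bar>x\<bar> < 1 \<Longrightarrow> (F has_real_derivative 1 / sqrt (1 - s * x\<^sup>2)) (at x)"
    and x: "\<bar>x\<bar> < 1"
  shows "(\<lambda>n. ode_coeff s p q n * x ^ n) sums (p * F x + q / 2 * (F x)\<^sup>2)"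
proof -
  let ?a = "ode_coeff s p q"
  let ?b = "diffs ?a"
  let ?c = "diffs ?b"
  define g where "g = (\<lambda>x. \<Sum>n. ?a n * x ^ n)"
  define g1 where "g1 = (\<lambda>x. \<Sum>n. ?b n * x ^ n)"
  define g2 where "g2 = (\<lambda>x. \<Sum>n. ?c n * x ^ n)"
  have sa: "summable (\<lambda>n. ?a n * x ^ n)" if "norm x < 1" for x
    using summable_abs_ode_series[OF s, of x p q] that by (auto intro: summable_rabs_cancel)
  have sb: "summable (\<lambda>n. ?b n * x ^ n)" if "norm x < 1" for x
    using termdiff_converges[OF that sa] .
  have sc: "summable (\<lambda>n. ?c n * x ^ n)" if "norm x < 1" for x
    using termdiff_converges[OF that sb] .
  have dg: "(g has_real_derivative g1 x) (at x)" if "\<bar>x\<bar> < 1" for x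
    unfolding g_def g1_def using that by (intro termdiffs_strong'[of 1] sa) auto
  have dg1: "(g1 has_real_derivative g2 x) (at x)" if "\<bar>x\<bar> < 1" for x
    unfolding g1_def g2_def using that by (intro termdiffs_strong'[of 1] sb) auto
  have g0: "g 0 = 0" "g1 0 = p"
    by (simp_all add: g_def g1_def diffs_def)
  have ode: "(1 - s * x\<^sup>2) * g2 x = s * x * g1 x + q" if "\<bar>x\<bar> < 1" for x
  proof -
    have "(\<lambda>n. ?b n * x ^ n) sums g1 x"
      unfolding g1_def using that by (intro summable_sums sb) auto
    from sums_mult[OF this, of x]
    have "(\<lambda>n. real (Suc n) * ?a (Suc n) * x ^ Suc n) sums (x * g1 x)"
      by (simp add: diffs_def mult_ac)
    then have 1: "(\<lambda>n. real n * ?a n * x ^ n) sums (x * g1 x)"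
      by (subst (asm) sums_Suc_iff) simp
    have c: "(\<lambda>n. ?c n * x ^ n) sums g2 x"
      unfolding g2_def using that by (intro summable_sums sc) auto
    from sums_mult[OF this, of "x\<^sup>2"]
    have "(\<lambda>n. real (Suc (Suc n)) * (real (Suc (Suc n)) - 1) * ?a (Suc (Suc n)) * x ^ Suc (Suc n)) sums (x\<^sup>2 * g2 x)"
      by (simp add: diffs_def mult_ac power2_eq_square)
    then have "(\<lambda>n. real (Suc n) * (real (Suc n) - 1) * ?a (Suc n) * x ^ Suc n) sums (x\<^sup>2 * g2 x)"
      by (subst (asm) sums_Suc_iff) simp
    then have 2: "(\<lambda>n. real n * (real n - 1) * ?a n * x ^ n) sums (x\<^sup>2 * g2 x)"
      by (subst (asm) sums_Suc_iff) simp
    have 3: "(\<lambda>n. if n = 0 then q else 0) sums q"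
      using sums_single[of 0 "\<lambda>_. q"] by simp
    \<comment> \<open>With \<open>n\<^sup>2 = n (n - 1) + n\<close> the recurrence expresses \<open>g2\<close> by \<open>x\<^sup>2 g2\<close> and \<open>x g1\<close>.\<close>
    have "?c n = s * (real n * (real n - 1) * ?a n + real n * ?a n) + (if n = 0 then q else 0)" for n
    proof -
      have "?c n = real (n + 1) * real (n + 2) * ?a (Suc (Suc n))"
        by (simp add: diffs_def mult_ac)
      also have "\<dots> = s * (real n)\<^sup>2 * ?a n + (if n = 0 then q else 0)"
        by (simp del: of_nat_add of_nat_Suc)
      finally show ?thesis
        by (simp add: algebra_simps power2_eq_square)
    qed
    then have "?c n * x ^ n = s * (real n * (real n - 1) * ?a n * x ^ n + real n * ?a n * x ^ n)
        + (if n = 0 then q else 0)" for n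
      by (simp add: algebra_simps)
    with sums_add[OF sums_mult[OF sums_add[OF 2 1], of s] 3]
    have "(\<lambda>n. ?c n * x ^ n) sums (s * (x\<^sup>2 * g2 x + x * g1 x) + q)"
      by simp
    with c have "g2 x = s * (x\<^sup>2 * g2 x + x * g1 x) + q"
      by (rule sums_unique2)
    then show ?thesis
      by (simp add: algebra_simps)
  qed
  have pos: "0 < 1 - s * x\<^sup>2" if "\<bar>x\<bar> < 1" for x
  proof -
    have "s * x\<^sup>2 \<le> x\<^sup>2"
      using s mult_right_mono[of s 1 "x\<^sup>2"] by auto
    moreover have "x\<^sup>2 < 1"
      using that by (simp add: abs_square_less_1)
    ultimately show ?thesis
      by simp
  qed
  have first: "sqrt (1 - s * x\<^sup>2) * g1 x = p + q * F x" if "\<bar>x\<bar> < 1" for x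
  proof -
    have "sqrt (1 - s * x\<^sup>2) * g1 x - q * F x = sqrt (1 - s * 0\<^sup>2) * g1 0 - q * F 0"
    proof (rule DERIV_isconst3[of "-1" 1 x 0 "\<lambda>x. sqrt (1 - s * x\<^sup>2) * g1 x - q * F x"])
      fix y :: real
      assume "y \<in> {-1<..<1}"
      then have y: "\<bar>y\<bar> < 1"
        by auto
      define r where "r = sqrt (1 - s * y\<^sup>2)"
      have r: "0 < r" "r * r = 1 - s * y\<^sup>2"
        using pos[OF y] by (auto simp: r_def)
      have "((\<lambda>x. sqrt (1 - s * x\<^sup>2) * g1 x - q * F x) has_real_derivative
          r * g2 y + (- (s * y) / r) * g1 y - q * (1 / r)) (at y)"
        unfolding r_def using pos[OF y]
        by (auto intro!: derivative_eq_intros dg1[OF y] F'[OF y] simp: field_simps)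
      also have "r * g2 y + (- (s * y) / r) * g1 y - q * (1 / r)
          = ((r * r) * g2 y - s * y * g1 y - q) / r"
        using r(1) by (simp add: field_simps)
      also have "\<dots> = 0"
        unfolding r(2) ode[OF y] by simp
      finally show "((\<lambda>x. sqrt (1 - s * x\<^sup>2) * g1 x - q * F x) has_real_derivative 0) (at y)" .
    qed (use that in auto)
    then show ?thesis
      by (simp add: F0 g0)
  qed
  have "g x - (p * F x + q / 2 * (F x)\<^sup>2) = g 0 - (p * F 0 + q / 2 * (F 0)\<^sup>2)"
  proof (rule DERIV_isconst3[of "-1" 1 x 0 "\<lambda>x. g x - (p * F x + q / 2 * (F x)\<^sup>2)"])
    fix y :: real
    assume "y \<in> {-1<..<1}"
    then have y: "\<bar>y\<bar> < 1"
      by auto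
    define r where "r = sqrt (1 - s * y\<^sup>2)"
    have r: "0 < r"
      using pos[OF y] by (auto simp: r_def)
    have "((\<lambda>x. g x - (p * F x + q / 2 * (F x)\<^sup>2)) has_real_derivative
        g1 y - (p * (1 / r) + q * (F y * (1 / r)))) (at y)"
      unfolding r_def by (auto intro!: derivative_eq_intros dg[OF y] F'[OF y])
    also have "g1 y - (p * (1 / r) + q * (F y * (1 / r))) = 0"
      using first[OF y, folded r_def] r by (simp add: field_simps)
    finally show "((\<lambda>x. g x - (p * F x + q / 2 * (F x)\<^sup>2)) has_real_derivative 0) (at y)" .
  qed (use x in auto)
  then have "g x = p * F x + q / 2 * (F x)\<^sup>2"
    by (simp add: F0 g0)
  moreover have "(\<lambda>n. ?a n * x ^ n) sums g x"
    unfolding g_def using x by (intro summable_sums sa) auto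
  ultimately show ?thesis
    by simp
qed

section \<open>Products of Taylor coefficients and Wallis integrals\<close>

text \<open>
  Passing from \<open>n\<close> to \<open>n + 2\<close> multiplies the coefficient by \<open>s n\<^sup>2 / ((n+1)(n+2))\<close> and the Wallis
  integral by \<open>(n+1) / (n+2)\<close>, so the product is multiplied by \<open>s n\<^sup>2 / (n+2)\<^sup>2\<close>.
\<close>
lemma wallis_ode_coeff_odd:
  "ode_coeff s p q (2 * k + 1) * wallis (2 * k + 1) = p * (s ^ k / (real (2 * k + 1))\<^sup>2)"
proof (induction k)
  case (Suc k)
  let ?n = "2 * k + 1"
  have "ode_coeff s p q (Suc (Suc ?n)) * wallis (Suc (Suc ?n))
      = s * (real ?n)\<^sup>2 / (real (?n + 2))\<^sup>2 * (ode_coeff s p q ?n * wallis ?n)"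
    unfolding ode_coeff.simps wallis.simps
    by (simp add: divide_simps power2_eq_square del: of_nat_add of_nat_mult of_nat_Suc ode_coeff.simps wallis.simps)
  then show ?case
    unfolding Suc.IH by (simp add: field_simps)
qed simp

text \<open>
  The same recurrence as for odd indices, now started at \<open>n = 2\<close>, where the coefficient is
  \<open>q / 2\<close> and the Wallis integral is \<open>\<pi> / 4\<close>.
\<close>
lemma wallis_ode_coeff_even:
  "ode_coeff s p q (2 * k + 2) * wallis (2 * k + 2) = q * pi / 8 * (s ^ k / (real (k + 1))\<^sup>2)"
proof (induction k)
  case (Suc k)
  let ?n = "2 * k + 2"
  have "ode_coeff s p q (Suc (Suc ?n)) * wallis (Suc (Suc ?n))
      = s * ((real ?n)\<^sup>2 / (real (?n + 2))\<^sup>2) * (ode_coeff s p q ?n * wallis ?n)"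
    unfolding ode_coeff.simps wallis.simps
    by (simp add: divide_simps power2_eq_square del: of_nat_add of_nat_mult of_nat_Suc ode_coeff.simps wallis.simps)
  also have "(real ?n)\<^sup>2 / (real (?n + 2))\<^sup>2 = (real (k + 1))\<^sup>2 / (real (k + 2))\<^sup>2"
    by (simp add: divide_simps power2_eq_square algebra_simps)
  finally show ?case
    unfolding Suc.IH by (simp add: field_simps)
qed (simp add: numeral_2_eq_2)

section \<open>Splitting the dilogarithm by parity\<close>

text \<open>
  The odd indices of \<open>f\<close> are the even indices \<open>n\<close> of the shifted sequence, hence the
  reversed order in the appeal to \<open>sums_if\<close>.
\<close>
lemma sums_odd_even:
  fixes f :: "nat \<Rightarrow> real"
  assumes "(\<lambda>k. f (2 * k + 1)) sums A" and "(\<lambda>k. f (2 * k + 2)) sums B"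
  shows "(\<lambda>n. f (n + 1)) sums (A + B)"
proof -
  have "(\<lambda>n. if even n then f (2 * (n div 2) + 1) else f (2 * ((n - 1) div 2) + 2)) sums (B + A)"
    using assms(2,1) by (rule sums_if)
  moreover have "(if even n then f (2 * (n div 2) + 1) else f (2 * ((n - 1) div 2) + 2)) = f (n + 1)" for n
    by (auto elim!: evenE oddE)
  ultimately show ?thesis
    by (simp add: add.commute)
qed

lemma summable_powers_over_squares:
  fixes x :: real
  assumes "\<bar>x\<bar> \<le> 1"
  shows "summable (\<lambda>n. x ^ (n + 1) / (real (n + 1))\<^sup>2)"
proof (rule summable_comparison_test')
  show "summable (\<lambda>n. 1 / (real (n + 1))\<^sup>2)"
    using inverse_power_summable[of 2, where 'a = real]
    by (subst summable_iff_shift[where k = 1 and f = "\<lambda>n. 1 / (real n)\<^sup>2"]) (simp add: inverse_eq_divide)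
  show "norm (x ^ (n + 1) / (real (n + 1))\<^sup>2) \<le> 1 / (real (n + 1))\<^sup>2" for n
    using assms power_le_one[of "\<bar>x\<bar>" "n + 1"]
    by (simp add: power_abs abs_mult divide_right_mono del: power_Suc)
qed

lemma Li2_sums: "\<bar>x\<bar> \<le> 1 \<Longrightarrow> (\<lambda>n. x ^ (n + 1) / (real (n + 1))\<^sup>2) sums Li2 x"
  unfolding Li2_def by (intro summable_sums summable_powers_over_squares)

lemma summable_odd_powers_over_squares:
  fixes s t :: real
  assumes "\<bar>s\<bar> \<le> 1" "\<bar>t\<bar> \<le> 1"
  shows "summable (\<lambda>k. s ^ k * t ^ (2 * k + 1) / (real (2 * k + 1))\<^sup>2)"
proof (rule summable_comparison_test')
  show "summable (\<lambda>n. 1 ^ (n + 1) / (real (n + 1))\<^sup>2)"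
    by (intro summable_powers_over_squares) auto
  show "norm (s ^ n * t ^ (2 * n + 1) / (real (2 * n + 1))\<^sup>2) \<le> 1 ^ (n + 1) / (real (n + 1))\<^sup>2" for n
  proof -
    have "\<bar>s\<bar> ^ n * \<bar>t\<bar> ^ (2 * n + 1) \<le> 1"
      using assms by (intro mult_le_one power_le_one) auto
    then have "\<bar>s\<bar> ^ n * \<bar>t\<bar> ^ (2 * n + 1) / (real (2 * n + 1))\<^sup>2 \<le> 1 / (real (n + 1))\<^sup>2"
      by (intro frac_le power_mono) auto
    then show ?thesis
      by (simp add: abs_mult power_abs)
  qed
qed

lemma chi2_sums:
  "\<bar>t\<bar> \<le> 1 \<Longrightarrow> (\<lambda>k. 1 ^ k * t ^ (2 * k + 1) / (real (2 * k + 1))\<^sup>2) sums chi2 t"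
  using summable_sums[OF summable_odd_powers_over_squares[of 1 t]] by (simp add: chi2_def)

lemma Ti2_sums:
  "\<bar>t\<bar> \<le> 1 \<Longrightarrow> (\<lambda>k. (-1) ^ k * t ^ (2 * k + 1) / (real (2 * k + 1))\<^sup>2) sums Ti2 t"
  using summable_sums[OF summable_odd_powers_over_squares[of "-1" t]] by (simp add: Ti2_def)

lemma square_power_plus_one: "(x\<^sup>2) ^ (k + 1) = x ^ (2 * k + 2)" for x :: real
proof -
  have "2 * k + 2 = 2 * (k + 1)"
    by simp
  then show ?thesis
    by (simp only: power_mult)
qed

lemma Li2_even_terms_sums:
  assumes "\<bar>x\<bar> \<le> 1"
  shows "(\<lambda>k. x ^ (2 * k + 2) / (real (2 * k + 2))\<^sup>2) sums (1 / 4 * Li2 (x\<^sup>2))"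
proof -
  have "(\<lambda>k. 1 / 4 * ((x\<^sup>2) ^ (k + 1) / (real (k + 1))\<^sup>2)) sums (1 / 4 * Li2 (x\<^sup>2))"
    using assms by (intro sums_mult Li2_sums) (simp add: abs_square_le_1)
  moreover have "1 / 4 * ((x\<^sup>2) ^ (k + 1) / (real (k + 1))\<^sup>2) = x ^ (2 * k + 2) / (real (2 * k + 2))\<^sup>2" for k
  proof -
    have "(real (2 * k + 2))\<^sup>2 = 4 * (real (k + 1))\<^sup>2"
      by (simp add: power2_eq_square algebra_simps)
    moreover have "(x\<^sup>2) ^ (k + 1) = x ^ (2 * k + 2)"
      by (rule square_power_plus_one)
    ultimately show ?thesis
      by simp
  qed
  ultimately show ?thesis
    by simp
qed

lemma Li2_eq_chi2_plus:
  assumes "\<bar>t\<bar> \<le> 1"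
  shows "Li2 t = chi2 t + 1 / 4 * Li2 (t\<^sup>2)"
proof -
  have "(\<lambda>n. t ^ (n + 1) / (real (n + 1))\<^sup>2) sums (chi2 t + 1 / 4 * Li2 (t\<^sup>2))"
    using sums_odd_even[of "\<lambda>n. t ^ n / (real n)\<^sup>2", OF _ Li2_even_terms_sums] chi2_sums assms
    by simp
  with Li2_sums[OF assms] show ?thesis
    by (rule sums_unique2)
qed

text \<open>
  Changing the sign of the even terms subtracts them twice.
\<close>
lemma alternating_Li2_sums:
  assumes "\<bar>x\<bar> \<le> 1"
  shows "(\<lambda>k. (-1) ^ k * x ^ (k + 1) / (real (k + 1))\<^sup>2) sums (Li2 x - 1 / 2 * Li2 (x\<^sup>2))"
proof -
  let ?e = "\<lambda>n. if even n then x ^ n / (real n)\<^sup>2 else 0"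
  have "(\<lambda>n. ?e (n + 1)) sums (0 + 1 / 4 * Li2 (x\<^sup>2))"
    using Li2_even_terms_sums[OF assms] by (intro sums_odd_even) auto
  from sums_diff[OF Li2_sums[OF assms] sums_mult[OF this, of 2]]
  have "(\<lambda>n. x ^ (n + 1) / (real (n + 1))\<^sup>2 - 2 * ?e (n + 1)) sums (Li2 x - 1 / 2 * Li2 (x\<^sup>2))"
    by simp
  moreover have "x ^ (n + 1) / (real (n + 1))\<^sup>2 - 2 * ?e (n + 1)
      = (-1) ^ n * x ^ (n + 1) / (real (n + 1))\<^sup>2" for n
    by (cases "even n") auto
  ultimately show ?thesis
    by simp
qed

section \<open>The integral formulas\<close>

lemma summable_abs_wallis_ode_coeff:
  assumes "\<bar>s\<bar> \<le> 1"
  shows "summable (\<lambda>n. \<bar>ode_coeff s p q n * wallis n\<bar>)"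
proof -
  let ?b = "\<lambda>n. \<bar>ode_coeff s p q n * wallis n\<bar>"
  have s: "\<bar>\<bar>s\<bar>\<bar> \<le> 1"
    using assms by simp
  have "(\<lambda>k. ?b (2 * k + 1)) = (\<lambda>k. \<bar>p\<bar> * (\<bar>s\<bar> ^ k * 1 ^ (2 * k + 1) / (real (2 * k + 1))\<^sup>2))"
    unfolding wallis_ode_coeff_odd by (simp add: abs_mult power_abs)
  then have odd: "summable (\<lambda>k. ?b (2 * k + 1))"
    using summable_mult[OF summable_odd_powers_over_squares[OF s, of 1], of "\<bar>p\<bar>"] by (simp only:)
  have "summable (\<lambda>k. \<bar>s\<bar> ^ k / (real (k + 1))\<^sup>2)"
  proof (rule summable_comparison_test')
    show "summable (\<lambda>n. 1 ^ (n + 1) / (real (n + 1))\<^sup>2)"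
      by (intro summable_powers_over_squares) auto
    show "norm (\<bar>s\<bar> ^ n / (real (n + 1))\<^sup>2) \<le> 1 ^ (n + 1) / (real (n + 1))\<^sup>2" for n
      using assms power_le_one[of "\<bar>s\<bar>" n] by (simp add: divide_right_mono)
  qed
  moreover have "(\<lambda>k. ?b (2 * k + 2)) = (\<lambda>k. \<bar>q * pi / 8\<bar> * (\<bar>s\<bar> ^ k / (real (k + 1))\<^sup>2))"
    unfolding wallis_ode_coeff_even by (simp only: abs_mult power_abs abs_divide) simp
  ultimately have even: "summable (\<lambda>k. ?b (2 * k + 2))"
    by (simp only: summable_mult)
  have "summable (\<lambda>n. ?b (n + 1))"
    using sums_odd_even[OF summable_sums[OF odd] summable_sums[OF even]] by (rule sums_summable)
  then show ?thesis
    by (subst (asm) summable_iff_shift)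
qed

text \<open>
  The formula common to all five identities. The sums \<open>A\<close> and \<open>B\<close> are left abstract so that
  each instance can supply its own closed form.
\<close>
lemma has_integral_arc_over_sqrt:
  fixes F :: "real \<Rightarrow> real"
  assumes s: "\<bar>s\<bar> \<le> 1" and F0: "F 0 = 0"
    and F': "\<And>x. \<bar>x\<bar> < 1 \<Longrightarrow> (F has_real_derivative 1 / sqrt (1 - s * x\<^sup>2)) (at x)"
    and t: "0 \<le> t" "t \<le> 1"
    and A: "(\<lambda>k. s ^ k * t ^ (2 * k + 1) / (real (2 * k + 1))\<^sup>2) sums A"
    and B: "(\<lambda>k. s ^ k * (t\<^sup>2) ^ (k + 1) / (real (k + 1))\<^sup>2) sums B"
  shows "((\<lambda>u. (p * F (t * u) + q / 2 * (F (t * u))\<^sup>2) / sqrt (1 - u\<^sup>2))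
           has_integral (p * A + q * pi / 8 * B)) {0..1}"
proof -
  let ?a = "ode_coeff s p q"
  let ?b = "\<lambda>n. ?a n * wallis n * t ^ n"
  have "(\<lambda>n. ?b (n + 1)) sums (p * A + q * pi / 8 * B)"
  proof (rule sums_odd_even)
    show "(\<lambda>k. ?b (2 * k + 1)) sums (p * A)"
      unfolding wallis_ode_coeff_odd using sums_mult[OF A, of p] by (simp add: mult_ac)
    show "(\<lambda>k. ?b (2 * k + 2)) sums (q * pi / 8 * B)"
      unfolding wallis_ode_coeff_even square_power_plus_one[symmetric]
      using sums_mult[OF B, of "q * pi / 8"]
      by (simp add: mult_ac)
  qed
  then have "?b sums (p * A + q * pi / 8 * B)"
    using sums_Suc_iff[of ?b] by simp
  then show ?thesis
    using ode_series_sums[OF s F0 F'] summable_abs_ode_series[OF s] summable_abs_wallis_ode_coeff[OF s] t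
    by (intro has_integral_powser_over_sqrt[where a = ?a and f = "\<lambda>x. p * F x + q / 2 * (F x)\<^sup>2"]) auto
qed

theorem theorem2p8:
  fixes t :: real
  assumes "0 \<le> t" and "t \<le> 1"
  shows
    "((\<lambda>u. arcsin (t * u) / sqrt (1 - u\<^sup>2)) integrable_on {0..1} \<and>
      chi2 t = integral {0..1} (\<lambda>u. arcsin (t * u) / sqrt (1 - u\<^sup>2))) \<and>
     ((\<lambda>u. (arcsin (t * u))\<^sup>2 / sqrt (1 - u\<^sup>2)) integrable_on {0..1} \<and>
      1 / 4 * Li2 (t\<^sup>2) = 1 / pi * integral {0..1} (\<lambda>u. (arcsin (t * u))\<^sup>2 / sqrt (1 - u\<^sup>2))) \<and>
     ((\<lambda>u. (arcsin (t * u) + 1 / pi * (arcsin (t * u))\<^sup>2) / sqrt (1 - u\<^sup>2)) integrable_on {0..1} \<and>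
      Li2 t = integral {0..1} (\<lambda>u. (arcsin (t * u) + 1 / pi * (arcsin (t * u))\<^sup>2) / sqrt (1 - u\<^sup>2))) \<and>
     ((\<lambda>u. arsinh (t * u) / sqrt (1 - u\<^sup>2)) integrable_on {0..1} \<and>
      Ti2 t = integral {0..1} (\<lambda>u. arsinh (t * u) / sqrt (1 - u\<^sup>2))) \<and>
     ((\<lambda>u. (1 / 2 * (arsinh (t * u))\<^sup>2) / sqrt (1 - u\<^sup>2)) integrable_on {0..1} \<and>
      pi / 2 * (1 / 4 * Li2 (t\<^sup>2) - 1 / 8 * Li2 (t ^ 4)) =
        integral {0..1} (\<lambda>u. (1 / 2 * (arsinh (t * u))\<^sup>2) / sqrt (1 - u\<^sup>2)))"
proof -
  have t: "\<bar>t\<bar> \<le> 1" "\<bar>t\<^sup>2\<bar> \<le> 1"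
    using assms by (auto simp: abs_square_le_1)
  have arcsin_int: "((\<lambda>u. (p * arcsin (t * u) + q / 2 * (arcsin (t * u))\<^sup>2) / sqrt (1 - u\<^sup>2))
      has_integral (p * chi2 t + q * pi / 8 * Li2 (t\<^sup>2))) {0..1}" for p q
  proof (rule has_integral_arc_over_sqrt[where s = 1])
    show "(arcsin has_real_derivative 1 / sqrt (1 - 1 * x\<^sup>2)) (at x)" if "\<bar>x\<bar> < 1" for x
      using that DERIV_arcsin[of x] by (auto simp: inverse_eq_divide)
    show "(\<lambda>k. 1 ^ k * (t\<^sup>2) ^ (k + 1) / (real (k + 1))\<^sup>2) sums Li2 (t\<^sup>2)"
      using Li2_sums[OF t(2)] by simp
  qed (use assms chi2_sums[OF t(1)] in auto)
  have arsinh_int: "((\<lambda>u. (p * arsinh (t * u) + q / 2 * (arsinh (t * u))\<^sup>2) / sqrt (1 - u\<^sup>2))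
      has_integral (p * Ti2 t + q * pi / 8 * (Li2 (t\<^sup>2) - 1 / 2 * Li2 (t ^ 4)))) {0..1}" for p q
  proof (rule has_integral_arc_over_sqrt[where s = "-1"])
    show "(arsinh has_real_derivative 1 / sqrt (1 - (-1) * x\<^sup>2)) (at x)" for x :: real
      using arsinh_real_has_field_derivative[of x] by (simp add: add.commute)
    show "(\<lambda>k. (-1) ^ k * (t\<^sup>2) ^ (k + 1) / (real (k + 1))\<^sup>2) sums (Li2 (t\<^sup>2) - 1 / 2 * Li2 (t ^ 4))"
      using alternating_Li2_sums[OF t(2)] by (simp flip: power_mult)
  qed (use assms Ti2_sums[OF t(1)] in auto)
  \<comment> \<open>The weights \<open>p\<close>, \<open>q\<close> select \<open>F\<close>, \<open>F\<^sup>2\<close>, \<open>F + F\<^sup>2 / \<pi>\<close> and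
    \<open>F\<^sup>2 / 2\<close>; the third needs \<open>Li2\<close> split by parity.\<close>
  show ?thesis
    using arcsin_int[of 1 0] arcsin_int[of 0 2] arcsin_int[of 1 "2 / pi"]
      arsinh_int[of 1 0] arsinh_int[of 0 1] Li2_eq_chi2_plus[OF t(1)]
    by (simp add: has_integral_iff algebra_simps)
qed

end
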